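(* Let $\mathcal H$ be an infinite-dimensional complex Hilbert space, let $m,q\ge1$ be integers, and let $\mathbf A=(A_1,\dots,A_m)$ be an $m$-tuple of bounded self-adjoint operators on $\mathcal H$. Then $$W_{ess}(q:\mathbf A)=\bigcap\{\mathbf{cl}(W(q:\mathbf A+\mathbf G)):\mathbf G\in\mathcal S_{\mathcal K}(\mathcal H)^m\},$$ where $\mathcal S_{\mathcal K}(\mathcal H)$ is the set of self-adjoint compact operators on $\mathcal H$ and $\mathbf A+\mathbf G=(A_1+G_1,\dots,A_m+G_m)$.
   Context: Let $\mathbf M_q$ be the space of $q\times q$ complex matrices; $\mathbf{cl}$ denotes closure in $\mathbf M_q^m$. For bounded operators $\mathbf A=(A_1,\dots,A_m)$ on $\mathcal H$, the joint $q$-matricial range is $W(q:\mathbf A)=\{(X^*A_1X,\dots,X^*A_mX):X:\mathbb C^q\to\mathcal H\text{ a linear isometry}\}\subseteq\mathbf M_q^m$. The joint essential $q$-matricial range is defined with finite rank perturbations: $$W_{ess}(q:\mathbf A)=\bigcap\{\mathbf{cl}(W(q:(A_1+F_1,\dots,A_m+F_m))):F_1,\dots,F_m\in\mathcal B(\mathcal H)\text{ of finite rank}\}.$$ *)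

theory Defs
  imports "HOL-Analysis.Analysis"
begin

text \<open>
  The library has no complex inner product spaces.  The inner product is antilinear in its
  first argument; the real inner product of the superclass is required to be its real part,
  so that norm, metric and topology are the ones induced by the complex inner product.
\<close>

class complex_inner = real_inner +
  fixes scaleC :: "complex \<Rightarrow> 'a \<Rightarrow> 'a" (infixr \<open>*\<^sub>C\<close> 75)
    and cinner :: "'a \<Rightarrow> 'a \<Rightarrow> complex"
  assumes scaleC_add_right: "c *\<^sub>C (x + y) = c *\<^sub>C x + c *\<^sub>C y"
    and scaleC_add_left: "(c + d) *\<^sub>C x = c *\<^sub>C x + d *\<^sub>C x"
    and scaleC_scaleC: "c *\<^sub>C d *\<^sub>C x = (c * d) *\<^sub>C x"
    and scaleC_of_real: "complex_of_real r *\<^sub>C x = r *\<^sub>R x"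
    and cinner_commute: "cinner x y = cnj (cinner y x)"
    and cinner_add_right: "cinner x (y + z) = cinner x y + cinner x z"
    and cinner_scaleC_right: "cinner x (c *\<^sub>C y) = c * cinner x y"
    and inner_eq_Re_cinner: "inner x y = Re (cinner x y)"

class chilbert_space = complex_inner + complete_space

lemma (in complex_inner) cinner_self: "cinner x x = complex_of_real ((norm x)\<^sup>2)"
proof -
  have "Im (cinner x x) = 0"
    using arg_cong[OF cinner_commute[of x x], of Im] by simp
  then show ?thesis
    by (simp add: complex_eq_iff power2_norm_eq_inner inner_eq_Re_cinner)
qed

global_interpretation complex_vector: vector_space "scaleC :: complex \<Rightarrow> 'a \<Rightarrow> 'a::complex_inner"
proof
  fix a b :: complex and x y :: 'a
  show "1 *\<^sub>C x = x"
    using scaleC_of_real[of 1 x] by simp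
qed (simp_all add: scaleC_add_right scaleC_add_left scaleC_scaleC)

instantiation complex :: chilbert_space
begin

definition scaleC_complex :: "complex \<Rightarrow> complex \<Rightarrow> complex"
  where "scaleC_complex c x = c * x"

definition cinner_complex :: "complex \<Rightarrow> complex \<Rightarrow> complex"
  where "cinner_complex x y = cnj x * y"

instance
  by standard
    (auto simp: scaleC_complex_def cinner_complex_def algebra_simps inner_complex_def
      scaleR_conv_of_real)

end

instantiation vec :: (complex_inner, finite) complex_inner
begin

definition scaleC_vec :: "complex \<Rightarrow> 'a ^ 'b \<Rightarrow> 'a ^ 'b"
  where "scaleC_vec c x = (\<chi> i. c *\<^sub>C (x $ i))"

definition cinner_vec :: "'a ^ 'b \<Rightarrow> 'a ^ 'b \<Rightarrow> complex"
  where "cinner_vec x y = (\<Sum>i\<in>UNIV. cinner (x $ i) (y $ i))"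

instance
proof
  fix x y :: "'a ^ 'b"
  show "cinner x y = cnj (cinner y x)"
    unfolding cinner_vec_def cnj_sum by (rule sum.cong[OF refl]) (rule cinner_commute)
qed (auto simp: vec_eq_iff scaleC_vec_def cinner_vec_def scaleC_add_right scaleC_add_left
      scaleC_scaleC scaleC_of_real cinner_add_right cinner_scaleC_right sum.distrib
      sum_distrib_left inner_vec_def inner_eq_Re_cinner)

end

instance vec :: (chilbert_space, finite) chilbert_space ..

definition clinear :: "('a::complex_inner \<Rightarrow> 'b::complex_inner) \<Rightarrow> bool"
  where "clinear f \<longleftrightarrow> Vector_Spaces.linear scaleC scaleC f"

definition bounded_clinear :: "('a::complex_inner \<Rightarrow> 'b::complex_inner) \<Rightarrow> bool"
  where "bounded_clinear f \<longleftrightarrow> clinear f \<and> bounded_linear f"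

definition clinear_isometry :: "('a::complex_inner \<Rightarrow> 'b::complex_inner) \<Rightarrow> bool"
  where "clinear_isometry X \<longleftrightarrow> clinear X \<and> (\<forall>v. norm (X v) = norm v)"

definition is_cadjoint ::
    "('a::complex_inner \<Rightarrow> 'b::complex_inner) \<Rightarrow> ('b \<Rightarrow> 'a) \<Rightarrow> bool"
  where "is_cadjoint F G \<longleftrightarrow> (\<forall>x y. cinner (F x) y = cinner x (G y))"

definition cadjoint :: "('a::complex_inner \<Rightarrow> 'b::complex_inner) \<Rightarrow> 'b \<Rightarrow> 'a"
  where "cadjoint F = (SOME G. is_cadjoint F G)"

text \<open>
  The two lemmas below ensure that the choice in \<^const>\<open>cadjoint\<close> is harmless: adjoints are
  unique, and every linear map out of \<open>\<complex>\<^sup>q\<close> has one.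
\<close>

lemma cadjoint_eq:
  assumes "is_cadjoint F G"
  shows "cadjoint F = G"
  unfolding cadjoint_def
proof (rule some_equality[of "is_cadjoint F", OF assms])
  fix H assume H: "is_cadjoint F H"
  have "H y = G y" for y
  proof -
    have "inner x (H y) = inner x (G y)" for x
      using H assms by (metis is_cadjoint_def inner_eq_Re_cinner)
    then show ?thesis
      by (metis inner_eq_zero_iff inner_diff_right right_minus_eq)
  qed
  then show "H = G" ..
qed

lemma cadjoint_vec:
  fixes X :: "complex ^ 'q \<Rightarrow> 'a::complex_inner"
  assumes "clinear X"
  shows "is_cadjoint X (cadjoint X)"
    and "cadjoint X = (\<lambda>h. \<chi> i. cinner (X (axis i 1)) h)"
proof -
  interpret X: Vector_Spaces.linear "scaleC :: complex \<Rightarrow> complex ^ 'q \<Rightarrow> _"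
    "scaleC :: complex \<Rightarrow> 'a \<Rightarrow> _" X
    using assms by (simp add: clinear_def)
  have add_left: "cinner (x + y) z = cinner x z + cinner y z" for x y z :: 'a
    by (metis cinner_commute cinner_add_right complex_cnj_add)
  have scale_left: "cinner (c *\<^sub>C x) z = cnj c * cinner x z" for c and x z :: 'a
    by (metis cinner_commute cinner_scaleC_right complex_cnj_mult)
  have zero_left: "cinner 0 z = 0" for z :: 'a
    using add_left[of 0 0 z] by simp
  have sum_left: "cinner (\<Sum>i\<in>I. f i) z = (\<Sum>i\<in>I. cinner (f i) z)"
    if "finite I" for I :: "'q set" and f :: "'q \<Rightarrow> 'a" and z
    using that by (induction I) (simp_all add: zero_left add_left)
  have adj: "is_cadjoint X (\<lambda>h. \<chi> i. cinner (X (axis i 1)) h)"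
    unfolding is_cadjoint_def
  proof (intro allI)
    fix v :: "complex ^ 'q" and h
    have "v = (\<Sum>i\<in>UNIV. (v $ i) *\<^sub>C axis i 1)"
      by (simp add: vec_eq_iff scaleC_vec_def scaleC_complex_def axis_def if_distrib
          sum.delta cong: if_cong)
    then have "X v = (\<Sum>i\<in>UNIV. (v $ i) *\<^sub>C X (axis i 1))"
      by (metis (no_types, lifting) X.scale X.sum sum.cong)
    then show "cinner (X v) h = cinner v (\<chi> i. cinner (X (axis i 1)) h)"
      by (simp add: sum_left scale_left cinner_vec_def cinner_complex_def)
  qed
  show "cadjoint X = (\<lambda>h. \<chi> i. cinner (X (axis i 1)) h)"
    using cadjoint_eq[OF adj] .
  with adj show "is_cadjoint X (cadjoint X)" by simp
qed

definition selfadjoint :: "('a::complex_inner \<Rightarrow> 'a) \<Rightarrow> bool"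
  where "selfadjoint A \<longleftrightarrow> bounded_clinear A \<and> is_cadjoint A A"

definition compact_op :: "('a::complex_inner \<Rightarrow> 'b::complex_inner) \<Rightarrow> bool"
  where "compact_op K \<longleftrightarrow>
    bounded_clinear K \<and> (\<forall>S. bounded S \<longrightarrow> compact (closure (K ` S)))"

definition finite_rank_op :: "('a::complex_inner \<Rightarrow> 'b::complex_inner) \<Rightarrow> bool"
  where "finite_rank_op F \<longleftrightarrow>
    bounded_clinear F \<and> (\<exists>B. finite B \<and> range F \<subseteq> complex_vector.span B)"

definition cfinite_dim :: "'a::complex_inner itself \<Rightarrow> bool"
  where "cfinite_dim _ \<longleftrightarrow> (\<exists>B::'a set. finite B \<and> complex_vector.span B = UNIV)"

text \<open>
  Tuples of operators are families indexed by a finite type \<open>'m\<close>, and \<open>q\<close> is the cardinality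
  of the finite type \<open>'q\<close>; it is determined by the type of the result.
\<close>

definition joint_matricial_range ::
    "('m::finite \<Rightarrow> 'a::complex_inner \<Rightarrow> 'a) \<Rightarrow> (complex ^ 'q ^ 'q ^ 'm) set"
  where "joint_matricial_range A =
    {(\<chi> k. matrix (cadjoint X \<circ> A k \<circ> X)) | X :: complex ^ 'q \<Rightarrow> 'a. clinear_isometry X}"

definition joint_ess_matricial_range ::
    "('m::finite \<Rightarrow> 'a::complex_inner \<Rightarrow> 'a) \<Rightarrow> (complex ^ 'q ^ 'q ^ 'm) set"
  where "joint_ess_matricial_range A =
    \<Inter> {closure (joint_matricial_range (\<lambda>k x. A k x + F k x)) | F. \<forall>k. finite_rank_op (F k)}"

end

theory Submission
  imports Defs
begin

text \<open>
  One inclusion holds because compact operators are norm limits of finite rank operators.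
  For the other, let \<open>M\<close> lie in the right-hand intersection and let \<open>F\<close> be a tuple of finite rank
  operators, not necessarily self-adjoint.  Let \<open>P\<close> be the projection onto a finite-dimensional
  space containing all their ranges, and let \<open>d\<close> be a point of the joint essential numerical range
  (the case \<open>q = 1\<close>), which is nonempty by compactness.  The tuple \<open>(I - P) A (I - P) + d P\<close> is a
  self-adjoint compact perturbation of \<open>A\<close>, so some isometry \<open>X\<close> compresses it to nearly \<open>M\<close>.
  Replace \<open>P X\<close> by \<open>J P X\<close>, where \<open>J\<close> maps the range of \<open>P\<close> isometrically onto a space orthogonal
  to everything in sight, with \<open>J* A J\<close> close to \<open>d I\<close>.  Then \<open>(I - P) X + J P X\<close> is an isometry
  with nearly the same compression, now of \<open>A\<close> itself, and since its range is orthogonal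
  to that of \<open>F\<close>, it compresses \<open>A + F\<close> to the same tuple.
\<close>

section \<open>Complex inner product: sesquilinearity, norm and Cauchy-Schwarz\<close>

lemma cinner_add_left: "cinner (x + y) z = cinner x z + cinner y z"
  by (metis cinner_commute cinner_add_right complex_cnj_add)

lemma cinner_scaleC_left: "cinner (c *\<^sub>C x) z = cnj c * cinner x z"
  by (metis cinner_commute cinner_scaleC_right complex_cnj_mult)

lemma cinner_zero_left [simp]: "cinner 0 z = 0"
  using cinner_add_left[of 0 0 z] by simp

lemma cinner_zero_right [simp]: "cinner z 0 = 0"
  using cinner_add_right[of z 0 0] by simp

lemma cinner_minus_left: "cinner (- x) z = - cinner x z"
  using cinner_add_left[of x "- x" z] by (simp add: add_eq_0_iff)

lemma cinner_minus_right: "cinner z (- x) = - cinner z x"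
  using cinner_add_right[of z x "- x"] by (simp add: add_eq_0_iff)

lemma cinner_diff_left: "cinner (x - y) z = cinner x z - cinner y z"
  using cinner_add_left[of x "- y" z] by (simp add: cinner_minus_left)

lemma cinner_diff_right: "cinner z (x - y) = cinner z x - cinner z y"
  using cinner_add_right[of z x "- y"] by (simp add: cinner_minus_right)

lemma cinner_sum_left: "cinner (\<Sum>i\<in>I. f i) z = (\<Sum>i\<in>I. cinner (f i) z)"
  by (induction I rule: infinite_finite_induct) (simp_all add: cinner_add_left)

lemma cinner_sum_right: "cinner z (\<Sum>i\<in>I. f i) = (\<Sum>i\<in>I. cinner z (f i))"
  by (induction I rule: infinite_finite_induct) (simp_all add: cinner_add_right)

lemma cinner_eq_0_sym: "cinner x y = 0 \<longleftrightarrow> cinner y x = 0"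
  by (metis cinner_commute complex_cnj_zero)

lemma norm_scaleC: "norm (c *\<^sub>C x) = cmod c * norm x"
proof -
  have "complex_of_real ((norm (c *\<^sub>C x))\<^sup>2) = cnj c * c * complex_of_real ((norm x)\<^sup>2)"
    by (metis cinner_self cinner_scaleC_left cinner_scaleC_right mult.assoc)
  also have "\<dots> = complex_of_real ((cmod c * norm x)\<^sup>2)"
    by (simp add: power_mult_distrib complex_norm_square mult.commute flip: of_real_power)
  finally have "(norm (c *\<^sub>C x))\<^sup>2 = (cmod c * norm x)\<^sup>2"
    using of_real_eq_iff by blast
  then show ?thesis
    by (simp add: power2_eq_iff_nonneg)
qed

text \<open>The real Cauchy-Schwarz inequality controls only the real part. Rotating
  \<open>y\<close> by a unimodular \<open>c\<close> makes the inner product real and nonnegative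
  without changing norms.\<close>

lemma cmod_cinner_le: "cmod (cinner x y) \<le> norm x * norm y"
proof (cases "cinner x y = 0")
  case False
  define c where "c = cnj (cinner x y) / complex_of_real (cmod (cinner x y))"
  have c: "cmod c = 1"
    using False by (simp add: c_def norm_divide)
  have "cinner x (c *\<^sub>C y) = cinner x y * cnj (cinner x y) / complex_of_real (cmod (cinner x y))"
    by (simp add: cinner_scaleC_right c_def)
  also have "\<dots> = complex_of_real (cmod (cinner x y))"
    using False by (simp add: complex_norm_square[symmetric] power2_eq_square)
  finally have "cmod (cinner x y) = inner x (c *\<^sub>C y)"
    by (simp add: inner_eq_Re_cinner)
  also have "\<dots> \<le> norm x * norm (c *\<^sub>C y)"
    by (rule norm_cauchy_schwarz)
  finally show ?thesis
    by (simp add: norm_scaleC c)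
qed simp

lemma bounded_linear_scaleC_left: "bounded_linear (\<lambda>c. c *\<^sub>C x)"
proof (rule bounded_linear_intro[where K = "norm x"])
  show "(r *\<^sub>R c) *\<^sub>C x = r *\<^sub>R (c *\<^sub>C x)" for r c
    by (metis scaleC_of_real scaleC_scaleC scaleR_conv_of_real)
qed (simp_all add: scaleC_add_left norm_scaleC)

section \<open>Bounded complex-linear operators\<close>

lemma clinear_iff:
  "clinear f \<longleftrightarrow> (\<forall>x y. f (x + y) = f x + f y) \<and> (\<forall>c x. f (c *\<^sub>C x) = c *\<^sub>C f x)"
  unfolding clinear_def Vector_Spaces.linear_def module_hom_def module_hom_axioms_def
  by (auto intro: complex_vector.vector_space_axioms complex_vector.module_axioms)

lemma bounded_clinearI:
  assumes "\<And>x y. f (x + y) = f x + f y" "\<And>c x. f (c *\<^sub>C x) = c *\<^sub>C f x"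
    and "\<And>x. norm (f x) \<le> norm x * K"
  shows "bounded_clinear f"
proof -
  have "f (r *\<^sub>R x) = r *\<^sub>R f x" for r x
    by (metis assms(2) scaleC_of_real)
  then show ?thesis
    unfolding bounded_clinear_def clinear_iff
    using assms by (blast intro: bounded_linear_intro)
qed

lemma bounded_clinear_add:
  assumes "bounded_clinear f" "bounded_clinear g"
  shows "bounded_clinear (\<lambda>x. f x + g x)"
  using assms unfolding bounded_clinear_def clinear_iff
  by (simp add: bounded_linear_add scaleC_add_right algebra_simps)

lemma bounded_clinear_uminus:
  assumes "bounded_clinear f"
  shows "bounded_clinear (\<lambda>x. - f x)"
  using assms unfolding bounded_clinear_def clinear_iff
  by (simp add: bounded_linear_minus complex_vector.scale_minus_right)

lemma bounded_clinear_diff: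
  assumes "bounded_clinear f" "bounded_clinear g"
  shows "bounded_clinear (\<lambda>x. f x - g x)"
  using bounded_clinear_add[OF assms(1) bounded_clinear_uminus[OF assms(2)]] by simp

lemma bounded_clinear_compose:
  assumes "bounded_clinear f" "bounded_clinear g"
  shows "bounded_clinear (\<lambda>x. f (g x))"
  using assms unfolding bounded_clinear_def clinear_iff
  by (simp add: bounded_linear_compose)

lemma bounded_clinear_scaleC:
  assumes "bounded_clinear f"
  shows "bounded_clinear (\<lambda>x. c *\<^sub>C f x)"
proof -
  have "bounded_clinear (\<lambda>x. c *\<^sub>C x)"
    by (rule bounded_clinearI[where K = "cmod c"])
      (simp_all add: scaleC_add_right scaleC_scaleC norm_scaleC mult.commute)
  then show ?thesis
    using bounded_clinear_compose assms by blast
qed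

lemma bounded_clinear_ident: "bounded_clinear (\<lambda>x. x)"
  by (rule bounded_clinearI[where K = 1]) simp_all

section \<open>Orthonormal families and projections onto finite-dimensional subspaces\<close>

text \<open>Indexed families serve both for the columns of an isometry (index type
  \<open>'q\<close>) and for an orthonormal set \<open>E\<close>, indexed by itself through the
  identity.\<close>

definition orthonormal_on :: "'i set \<Rightarrow> ('i \<Rightarrow> 'a::complex_inner) \<Rightarrow> bool"
  where "orthonormal_on I x \<longleftrightarrow> (\<forall>i\<in>I. \<forall>j\<in>I. cinner (x i) (x j) = (if i = j then 1 else 0))"

lemma orthonormal_on_cinner:
  "orthonormal_on I x \<Longrightarrow> i \<in> I \<Longrightarrow> j \<in> I \<Longrightarrow> cinner (x i) (x j) = (if i = j then 1 else 0)"
  by (simp add: orthonormal_on_def)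

lemma norm_eq_1_iff_cinner: "norm x = 1 \<longleftrightarrow> cinner x x = 1"
proof -
  have "cinner x x = 1 \<longleftrightarrow> (norm x)\<^sup>2 = 1"
    unfolding cinner_self by (rule of_real_eq_1_iff)
  also have "\<dots> \<longleftrightarrow> norm x = 1"
    using norm_ge_zero[of x] by (auto simp: power2_eq_1_iff simp del: norm_ge_zero)
  finally show ?thesis ..
qed

lemma orthonormal_on_norm: "orthonormal_on I x \<Longrightarrow> i \<in> I \<Longrightarrow> norm (x i) = 1"
  by (simp add: norm_eq_1_iff_cinner orthonormal_on_cinner)

lemma cinner_sum_orthonormal:
  assumes "orthonormal_on I x" "finite I"
  shows "cinner (\<Sum>i\<in>I. a i *\<^sub>C x i) (\<Sum>i\<in>I. b i *\<^sub>C x i) = (\<Sum>i\<in>I. cnj (a i) * b i)"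
proof -
  have "cinner (\<Sum>i\<in>I. a i *\<^sub>C x i) (\<Sum>i\<in>I. b i *\<^sub>C x i)
      = (\<Sum>i\<in>I. \<Sum>j\<in>I. cnj (a i) * b j * cinner (x i) (x j))"
    by (simp add: cinner_sum_left cinner_sum_right cinner_scaleC_left cinner_scaleC_right
        sum_distrib_left mult_ac) (rule sum.swap)
  also have "\<dots> = (\<Sum>i\<in>I. \<Sum>j\<in>I. if i = j then cnj (a i) * b j else 0)"
    by (intro sum.cong refl) (simp add: orthonormal_on_cinner[OF assms(1)])
  finally show ?thesis
    using assms(2) by simp
qed

text \<open>For finite orthonormal \<open>E\<close> this is the orthogonal projection onto the span
  of \<open>E\<close>. Linearity and symmetry already hold for arbitrary \<open>E\<close>;
  idempotence and contractivity use orthonormality.\<close>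

definition proj :: "'a::complex_inner set \<Rightarrow> 'a \<Rightarrow> 'a"
  where "proj E x = (\<Sum>e\<in>E. cinner e x *\<^sub>C e)"

lemma proj_in_span: "proj E x \<in> complex_vector.span E"
  unfolding proj_def
  by (intro complex_vector.span_sum complex_vector.span_scale complex_vector.span_base)

lemma cinner_proj_left: "cinner (proj E x) y = cinner x (proj E y)"
  unfolding proj_def
  by (simp add: cinner_sum_left cinner_sum_right cinner_scaleC_left cinner_scaleC_right
      cinner_commute[symmetric] mult.commute)

lemma proj_add: "proj E (x + y) = proj E x + proj E y"
  by (simp add: proj_def cinner_add_right scaleC_add_left sum.distrib)

lemma proj_diff: "proj E (x - y) = proj E x - proj E y"
  using proj_add[of E "x - y" y] by simp

lemma proj_scaleC: "proj E (c *\<^sub>C x) = c *\<^sub>C proj E x"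
  by (simp add: proj_def cinner_scaleC_right scaleC_scaleC complex_vector.scale_sum_right)

lemma cinner_proj_right:
  assumes "orthonormal_on E (\<lambda>e. e)" "finite E" "e \<in> E"
  shows "cinner e (proj E x) = cinner e x"
proof -
  have "cinner e (proj E x) = (\<Sum>f\<in>E. if e = f then cinner f x else 0)"
    unfolding proj_def cinner_sum_right
    using assms(3) by (intro sum.cong refl) (simp add: cinner_scaleC_right orthonormal_on_cinner[OF assms(1)])
  then show ?thesis
    using assms by simp
qed

lemma proj_proj:
  assumes "orthonormal_on E (\<lambda>e. e)" "finite E"
  shows "proj E (proj E x) = proj E x"
  by (subst (1 3) proj_def) (intro sum.cong refl, simp add: cinner_proj_right[OF assms])

lemma norm_proj_le:
  assumes "orthonormal_on E (\<lambda>e. e)" "finite E"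
  shows "norm (proj E x) \<le> norm x"
proof -
  have "cinner (proj E x) (proj E x) = cinner x (proj E x)"
    by (simp add: cinner_proj_left proj_proj[OF assms])
  then have "(norm (proj E x))\<^sup>2 = cmod (cinner x (proj E x))"
    by (metis abs_of_nonneg cinner_self norm_of_real zero_le_power2)
  also have "\<dots> \<le> norm x * norm (proj E x)"
    by (rule cmod_cinner_le)
  finally show ?thesis
    by (cases "proj E x = 0") (simp_all add: power2_eq_square)
qed

lemma bounded_clinear_proj:
  assumes "orthonormal_on E (\<lambda>e. e)" "finite E"
  shows "bounded_clinear (proj E)"
  by (rule bounded_clinearI[where K = 1]) (simp_all add: proj_add proj_scaleC norm_proj_le[OF assms])

text \<open>Gram-Schmidt, by induction on \<open>B\<close>. The invariant says that the projection
  fixes each element of \<open>B\<close>; linearity extends this to the span at the end.\<close>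

lemma orthonormal_basis_exists:
  fixes B :: "'a::complex_inner set"
  assumes "finite B"
  obtains E where "finite E" "orthonormal_on E (\<lambda>e. e)" "\<And>b. b \<in> complex_vector.span B \<Longrightarrow> proj E b = b"
proof -
  have "\<exists>E. finite E \<and> orthonormal_on E (\<lambda>e. e) \<and> (\<forall>b\<in>B. proj E b = b)"
    using assms
  proof (induction B)
    case empty
    show ?case by (rule exI[of _ "{}"]) (simp add: orthonormal_on_def)
  next
    case (insert b B)
    then obtain E where E: "finite E" "orthonormal_on E (\<lambda>e. e)" "\<And>b. b \<in> B \<Longrightarrow> proj E b = b"
      by blast
    define r where "r = b - proj E b"
    have rE: "cinner e r = 0" "cinner r e = 0" if "e \<in> E" for e
      using cinner_proj_right[OF E(2,1) that, of b] cinner_eq_0_sym[of e r]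
      by (simp_all add: r_def cinner_diff_right)
    show ?case
    proof (cases "r = 0")
      case True
      then show ?thesis
        using E by (intro exI[of _ E]) (auto simp: r_def)
    next
      case False
      define f where "f = complex_of_real (1 / norm r) *\<^sub>C r"
      have fE: "cinner e f = 0" "cinner f e = 0" if "e \<in> E" for e
        using rE[OF that] by (simp_all add: f_def cinner_scaleC_left cinner_scaleC_right)
      have "norm f = 1"
        using False by (simp add: f_def norm_scaleC norm_divide)
      then have ff: "cinner f f = 1"
        by (simp add: norm_eq_1_iff_cinner)
      have fnE: "f \<notin> E"
        using fE ff by force
      have "orthonormal_on (insert f E) (\<lambda>e. e)"
        using E(2) fE ff fnE unfolding orthonormal_on_def by auto
      moreover have step: "proj (insert f E) x = cinner f x *\<^sub>C f + proj E x" for x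
        using E(1) fnE by (simp add: proj_def)
      moreover have "proj (insert f E) b = b"
      proof -
        have "cinner r (proj E b) = 0"
          unfolding proj_def by (simp add: cinner_sum_right cinner_scaleC_right rE)
        \<comment> \<open>Since \<open>b\<close> is \<open>r + proj E b\<close> and \<open>r\<close>
          is orthogonal to \<open>E\<close>, the component of \<open>b\<close> along the normalized
          residual \<open>f\<close> is exactly \<open>r\<close>.\<close>
        then have "cinner r b = cinner r r"
          by (simp add: r_def cinner_diff_right)
        then have "cinner f b *\<^sub>C f = r"
          using False by (simp add: f_def cinner_scaleC_left scaleC_scaleC cinner_self power2_eq_square)
        then show ?thesis
          by (simp add: step r_def)
      qed
      moreover have "proj (insert f E) x = x" if "x \<in> B" for x
      proof -
        have "cinner f x = cinner f (proj E x)"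
          using E(3)[OF that] by simp
        also have "\<dots> = 0"
          unfolding proj_def by (simp add: cinner_sum_right cinner_scaleC_right fE)
        finally show ?thesis
          using E(3)[OF that] by (simp add: step)
      qed
      ultimately show ?thesis
        using E(1) by (intro exI[of _ "insert f E"]) auto
    qed
  qed
  then obtain E where E: "finite E" "orthonormal_on E (\<lambda>e. e)" "\<And>b. b \<in> B \<Longrightarrow> proj E b = b"
    by blast
  have "proj E b = b" if "b \<in> complex_vector.span B" for b
    using that
    by (induction rule: complex_vector.span_induct_alt)
      (simp_all add: E(3) proj_add proj_scaleC, simp add: proj_def)
  with E show thesis
    by (intro that) auto
qed

text \<open>Infinite dimension gives a vector outside the span of an orthonormal \<open>E\<close>
  whose projection fixes \<open>B\<close>. Its residual \<open>r\<close> is nonzero and killed by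
  \<open>proj E\<close>, hence orthogonal to each \<open>b = proj E b\<close>; then
  normalize.\<close>

lemma orthogonal_unit_vector_exists:
  fixes B :: "'a::complex_inner set"
  assumes "\<not> cfinite_dim TYPE('a)" "finite B"
  obtains e where "norm e = 1" "\<And>b. b \<in> B \<Longrightarrow> cinner b e = 0"
proof -
  obtain E where E: "finite E" "orthonormal_on E (\<lambda>e. e)"
    "\<And>b. b \<in> complex_vector.span B \<Longrightarrow> proj E b = b"
    using orthonormal_basis_exists[OF assms(2)] by metis
  obtain x where x: "x \<notin> complex_vector.span E"
    using assms(1) E(1) unfolding cfinite_dim_def by blast
  define r where "r = x - proj E x"
  have "r \<noteq> 0"
    using x proj_in_span[of E x] by (auto simp: r_def)
  have "proj E r = 0"
    by (simp add: r_def proj_diff proj_proj[OF E(2,1)])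
  then have rB: "cinner b r = 0" if "b \<in> B" for b
    using E(3)[of b] that cinner_proj_left[of E b r] by (simp add: complex_vector.span_base)
  show thesis
    using \<open>r \<noteq> 0\<close> rB
    by (intro that[of "complex_of_real (1 / norm r) *\<^sub>C r"])
      (simp_all add: norm_scaleC norm_divide cinner_scaleC_right)
qed

section \<open>Matricial ranges through orthonormal families\<close>

text \<open>An isometry out of \<complex>^q amounts to the orthonormal family of images of the
  standard basis vectors, and these give the entries of the compression. All later arguments use
  this form.\<close>

lemma joint_matricial_range_eq:
  "(joint_matricial_range A :: (complex ^ 'q ^ 'q ^ 'm) set) =
    {(\<chi> k i j. cinner (x i) (A k (x j))) | x. orthonormal_on UNIV x}"
proof (intro set_eqI iffI)
  fix M :: "complex ^ 'q ^ 'q ^ 'm"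
  assume "M \<in> joint_matricial_range A"
  then obtain X :: "complex ^ 'q \<Rightarrow> 'a" where X: "clinear_isometry X"
    and M: "M = (\<chi> k. matrix (cadjoint X \<circ> A k \<circ> X))"
    unfolding joint_matricial_range_def by blast
  have lin: "clinear X" and nrm: "\<And>v. norm (X v) = norm v"
    using X by (auto simp: clinear_isometry_def)
  \<comment> \<open>Polarization recovers the real inner product from norms; the imaginary part
    follows by replacing \<open>v\<close> with \<open>\<i> *\<^sub>C v\<close>.\<close>
  have inn: "inner (X u) (X v) = inner u v" for u v
    using lin nrm[of "u + v"] nrm[of u] nrm[of v] by (simp add: dot_norm clinear_iff)
  have cinn: "cinner (X u) (X v) = cinner u v" for u v
  proof -
    have Im: "Im (cinner a b) = - inner a (\<i> *\<^sub>C b)" for a b :: "'b::complex_inner"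
      by (simp add: inner_eq_Re_cinner cinner_scaleC_right)
    have "Im (cinner (X u) (X v)) = Im (cinner u v)"
      unfolding Im using lin inn[of u "\<i> *\<^sub>C v"] by (simp add: clinear_iff)
    then show ?thesis
      using inn[of u v] by (simp add: complex_eq_iff inner_eq_Re_cinner)
  qed
  have "cinner (axis i 1) (axis j 1 :: complex ^ 'q) = (if i = j then 1 else 0)" for i j
  proof -
    have "cinner (axis i 1) (axis j 1 :: complex ^ 'q) =
        (\<Sum>l\<in>UNIV. if l = i then (if i = j then 1 else 0) else 0)"
      unfolding cinner_vec_def by (intro sum.cong refl) (auto simp: axis_def cinner_complex_def)
    then show ?thesis by simp
  qed
  then have "orthonormal_on UNIV (\<lambda>i. X (axis i 1))"
    by (simp add: orthonormal_on_def cinn)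
  moreover have "M = (\<chi> k i j. cinner (X (axis i 1)) (A k (X (axis j 1))))"
    by (simp add: M matrix_def cadjoint_vec(2)[OF lin] vec_eq_iff)
  ultimately show "M \<in> {(\<chi> k i j. cinner (x i) (A k (x j))) | x. orthonormal_on UNIV x}"
    by (intro CollectI exI[of _ "\<lambda>i. X (axis i 1)"]) simp
next
  fix M :: "complex ^ 'q ^ 'q ^ 'm"
  assume "M \<in> {(\<chi> k i j. cinner (x i) (A k (x j))) | x. orthonormal_on UNIV x}"
  then obtain x where x: "orthonormal_on UNIV x" and M: "M = (\<chi> k i j. cinner (x i) (A k (x j)))"
    by blast
  define X where "X v = (\<Sum>i\<in>UNIV. (v $ i) *\<^sub>C x i)" for v :: "complex ^ 'q"
  have lin: "clinear X"
    unfolding clinear_iff X_def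
    by (simp add: scaleC_add_left sum.distrib scaleC_vec_def scaleC_complex_def scaleC_scaleC
        complex_vector.scale_sum_right)
  have "cinner (X v) (X v) = cinner v v" for v
    unfolding X_def cinner_sum_orthonormal[OF x finite] by (simp add: cinner_vec_def cinner_complex_def)
  then have "norm (X v) = norm v" for v
    by (metis inner_eq_Re_cinner norm_eq_sqrt_inner)
  then have "clinear_isometry X"
    using lin by (simp add: clinear_isometry_def)
  moreover have "X (axis j 1) = x j" for j
  proof -
    have "X (axis j 1) = (\<Sum>i\<in>UNIV. if i = j then x i else 0)"
      unfolding X_def by (intro sum.cong refl) (auto simp: axis_def)
    then show ?thesis by simp
  qed
  then have "M = (\<chi> k. matrix (cadjoint X \<circ> A k \<circ> X))"
    by (simp add: M matrix_def cadjoint_vec(2)[OF lin] vec_eq_iff)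
  ultimately show "M \<in> joint_matricial_range A"
    unfolding joint_matricial_range_def by blast
qed

lemma norm_vec_le_sum: "norm (x :: 'b::real_normed_vector ^ 'n) \<le> (\<Sum>i\<in>UNIV. norm (x $ i))"
  unfolding norm_vec_def by (rule L2_set_le_sum) simp

text \<open>In finite dimension, convergence in norm is entrywise convergence.\<close>

lemma closure_joint_matricial_range_iff:
  fixes M :: "complex ^ 'q ^ 'q ^ 'm"
  shows "M \<in> closure (joint_matricial_range A) \<longleftrightarrow>
    (\<forall>\<epsilon>>0. \<exists>x. orthonormal_on UNIV x \<and>
      (\<forall>k i j. cmod (cinner (x i) (A k (x j)) - M $ k $ i $ j) \<le> \<epsilon>))"
    (is "_ \<longleftrightarrow> ?R")
proof
  assume M: "M \<in> closure (joint_matricial_range A)"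
  show ?R
  proof (intro allI impI)
    fix \<epsilon> :: real assume "\<epsilon> > 0"
    with M obtain N where N: "N \<in> joint_matricial_range A" "dist N M < \<epsilon>"
      by (meson closure_approachable)
    then obtain x where x: "orthonormal_on UNIV x" "N = (\<chi> k i j. cinner (x i) (A k (x j)))"
      unfolding joint_matricial_range_eq by blast
    have "cmod ((N - M) $ k $ i $ j) \<le> \<epsilon>" for k i j
      using N(2) Finite_Cartesian_Product.norm_nth_le[of "N - M" k] Finite_Cartesian_Product.norm_nth_le[of "(N - M) $ k" i]
        Finite_Cartesian_Product.norm_nth_le[of "(N - M) $ k $ i" j]
      by (simp add: dist_norm)
    with x show "\<exists>x. orthonormal_on UNIV x \<and>
        (\<forall>k i j. cmod (cinner (x i) (A k (x j)) - M $ k $ i $ j) \<le> \<epsilon>)"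
      by auto
  qed
next
  assume R: ?R
  \<comment> \<open>\<open>c\<close> counts the scalar entries of the tuple; the factor 2 in the
    tolerance below yields a strict inequality.\<close>
  define c where "c = real CARD('m) * real CARD('q) * real CARD('q)"
  have "c > 0"
    by (simp add: c_def)
  show "M \<in> closure (joint_matricial_range A)"
    unfolding closure_approachable
  proof (intro allI impI)
    fix \<epsilon> :: real assume "\<epsilon> > 0"
    with \<open>c > 0\<close> have "\<epsilon> / (2 * c) > 0"
      by simp
    with R obtain x where x: "orthonormal_on UNIV x"
      and le: "\<And>k i j. cmod (cinner (x i) (A k (x j)) - M $ k $ i $ j) \<le> \<epsilon> / (2 * c)"
      by meson
    define N :: "complex ^ 'q ^ 'q ^ 'm" where "N = (\<chi> k i j. cinner (x i) (A k (x j)))"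
    have "norm (N - M) \<le> (\<Sum>k\<in>UNIV. norm ((N - M) $ k))"
      by (rule norm_vec_le_sum)
    also have "\<dots> \<le> (\<Sum>k\<in>UNIV. \<Sum>i\<in>UNIV. norm ((N - M) $ k $ i))"
      by (intro sum_mono norm_vec_le_sum)
    also have "\<dots> \<le> (\<Sum>k\<in>UNIV. \<Sum>i\<in>UNIV. \<Sum>j\<in>UNIV. norm ((N - M) $ k $ i $ j))"
      by (intro sum_mono norm_vec_le_sum)
    also have "\<dots> \<le> (\<Sum>k\<in>(UNIV::'m set). \<Sum>i\<in>(UNIV::'q set). \<Sum>j\<in>(UNIV::'q set). \<epsilon> / (2 * c))"
      using le by (intro sum_mono) (simp add: N_def)
    also have "\<dots> = c * (\<epsilon> / (2 * c))"
      by (simp add: c_def)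
    also have "\<dots> < \<epsilon>"
      using \<open>c > 0\<close> \<open>\<epsilon> > 0\<close> by simp
    finally have "dist N M < \<epsilon>"
      by (simp add: dist_norm)
    moreover have "N \<in> joint_matricial_range A"
      unfolding joint_matricial_range_eq using x N_def by blast
    ultimately show "\<exists>N\<in>joint_matricial_range A. dist N M < \<epsilon>"
      by blast
  qed
qed

section \<open>Compact operators: finite rank approximation and a compactness criterion\<close>

text \<open>Cover the image of the unit ball by finitely many balls of radius
  \<open>\<epsilon> / 2\<close> and follow \<open>K\<close> by the projection fixing their centres
  \<open>T\<close>. The bound on unit vectors is what orthonormal families call for.\<close>

lemma compact_op_finite_rank_approx:
  fixes K :: "'a::complex_inner \<Rightarrow> 'b::complex_inner"
  assumes "compact_op K" "\<epsilon> > 0"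
  obtains F where "finite_rank_op F" "\<And>x. norm x = 1 \<Longrightarrow> norm (K x - F x) \<le> \<epsilon>"
proof -
  have K: "bounded_clinear K" and "compact (closure (K ` cball 0 1))"
    using assms(1) by (auto simp: compact_op_def)
  then obtain T where T: "finite T" "closure (K ` cball 0 1) \<subseteq> (\<Union>t\<in>T. ball t (\<epsilon> / 2))"
    using assms(2) by (metis compact_eq_totally_bounded half_gt_zero)
  obtain E where E: "finite E" "orthonormal_on E (\<lambda>e. e)"
    "\<And>b. b \<in> complex_vector.span T \<Longrightarrow> proj E b = b"
    using orthonormal_basis_exists[OF T(1)] by metis
  show thesis
  proof
    show "finite_rank_op (\<lambda>x. proj E (K x))"
      unfolding finite_rank_op_def
      using bounded_clinear_compose[OF bounded_clinear_proj[OF E(2,1)] K] E(1) proj_in_span by blast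
    fix x :: 'a assume "norm x = 1"
    then have "K x \<in> closure (K ` cball 0 1)"
      by (intro closure_subset[THEN subsetD] imageI) simp
    then obtain t where t: "t \<in> T" "norm (K x - t) < \<epsilon> / 2"
      using T(2) by (auto simp: dist_norm norm_minus_commute)
    \<comment> \<open>As the projection fixes \<open>t\<close>, the error at \<open>K x\<close>
      equals the error at the short vector \<open>K x - t\<close>.\<close>
    have "proj E (K x) = proj E (K x - t) + proj E t"
      by (simp flip: proj_add)
    also have "proj E t = t"
      using E(3) t(1) by (simp add: complex_vector.span_base)
    finally have "K x - proj E (K x) = (K x - t) - proj E (K x - t)"
      by simp
    then have "norm (K x - proj E (K x)) \<le> norm (K x - t) + norm (proj E (K x - t))"
      by (metis norm_triangle_ineq4)
    then show "norm (K x - proj E (K x)) \<le> \<epsilon>"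
      using t(2) norm_proj_le[OF E(2,1), of "K x - t"] by linarith
  qed
qed

text \<open>By Cauchy-Schwarz each coefficient stays in a fixed disc, so the image lies in a finite
  sum of compact discs of multiples of the \<open>e\<close>.\<close>

lemma proj_image_bounded:
  assumes "bounded S"
  obtains C where "compact C" "proj E ` S \<subseteq> C"
proof -
  obtain R where R: "\<And>x. x \<in> S \<Longrightarrow> norm x \<le> R"
    using assms by (auto simp: bounded_iff)
  have "\<exists>C. compact C \<and> proj E ` S \<subseteq> C"
  proof (induction E rule: infinite_finite_induct)
    case (insert e E)
    then obtain C where C: "compact C" "proj E ` S \<subseteq> C"
      by blast
    define D where "D = (\<lambda>c. c *\<^sub>C e) ` cball 0 (norm e * R)"
    have "compact D"
      unfolding D_def
      by (intro compact_continuous_image compact_cball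
          linear_continuous_on bounded_linear_scaleC_left)
    have "proj (insert e E) x \<in> {u + v | u v. u \<in> D \<and> v \<in> C}" if "x \<in> S" for x
    proof -
      have "cmod (cinner e x) \<le> norm e * R"
        using cmod_cinner_le[of e x] mult_left_mono[OF R[OF that], of "norm e"] by simp
      then have "cinner e x *\<^sub>C e \<in> D"
        by (auto simp: D_def)
      moreover have "proj (insert e E) x = cinner e x *\<^sub>C e + proj E x"
        using insert by (simp add: proj_def)
      ultimately show ?thesis
        using C(2) that by blast
    qed
    then show ?case
      using compact_sums[OF \<open>compact D\<close> C(1)] by blast
  \<comment> \<open>For infinite or empty \<open>E\<close> the sum is 0, so \<open>{0}\<close>
    covers the image.\<close>
  qed (auto intro!: exI[of _ "{0}"] simp: proj_def)
  with that show thesis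
    by blast
qed

text \<open>Covering by a compact set passes easily to differences and continuous images, which
  suits operators assembled from projections.\<close>

lemma compact_opI:
  assumes "bounded_clinear K" "\<And>S. bounded S \<Longrightarrow> \<exists>C. compact C \<and> K ` S \<subseteq> C"
  shows "compact_op K"
  unfolding compact_op_def
proof (intro conjI allI impI)
  fix S :: "'a set" assume "bounded S"
  then obtain C where C: "compact C" "K ` S \<subseteq> C"
    using assms(2) by blast
  then have "closure (K ` S) \<subseteq> C"
    by (simp add: closure_minimal compact_imp_closed)
  then show "compact (closure (K ` S))"
    using compact_Int_closed[OF C(1) closed_closure, of "K ` S"] by (simp add: inf.absorb2)
qed (rule assms(1))

section \<open>The joint essential numerical range\<close>

text \<open>\<open>d\<close> lies in the joint essential numerical range of \<open>A\<close>.\<close>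

definition essential_value :: "('m \<Rightarrow> 'a::complex_inner \<Rightarrow> 'a) \<Rightarrow> ('m \<Rightarrow> real) \<Rightarrow> bool"
  where "essential_value A d \<longleftrightarrow> (\<forall>B \<epsilon>. finite B \<longrightarrow> \<epsilon> > 0 \<longrightarrow>
    (\<exists>e. norm e = 1 \<and> (\<forall>b\<in>B. cinner b e = 0) \<and>
      (\<forall>k. cmod (cinner e (A k e) - complex_of_real (d k)) < \<epsilon>)))"

text \<open>The closed sets \<open>S B\<close> of values reached off \<open>B\<close> lie in one
  compact ball. Finitely many of them share the value at a unit vector orthogonal to all the
  \<open>B\<close> involved, so the finite intersection property gives a common point.\<close>

lemma essential_value_exists:
  fixes A :: "'m::finite \<Rightarrow> 'a::complex_inner \<Rightarrow> 'a"
  assumes "\<not> cfinite_dim TYPE('a)" "\<And>k. selfadjoint (A k)"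
  obtains d where "essential_value A d"
proof -
  define w :: "'a \<Rightarrow> real ^ 'm" where "w e = (\<chi> k. Re (cinner e (A k e)))" for e
  define S where "S B = closure (w ` {e. norm e = 1 \<and> (\<forall>b\<in>B. cinner b e = 0)})" for B
  define R where "R = (\<Sum>k\<in>UNIV. onorm (A k))"
  have bl: "bounded_linear (A k)" for k
    using assms(2) by (auto simp: selfadjoint_def bounded_clinear_def)
  have "norm (w e) \<le> R" if "norm e = 1" for e
  proof -
    have "\<bar>w e $ k\<bar> \<le> onorm (A k)" for k
    proof -
      have "\<bar>w e $ k\<bar> \<le> cmod (cinner e (A k e))"
        by (simp add: w_def abs_Re_le_cmod)
      also have "\<dots> \<le> norm e * norm (A k e)"
        by (rule cmod_cinner_le)
      also have "\<dots> \<le> onorm (A k)"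
        using onorm[OF bl, of k e] that by simp
      finally show ?thesis .
    qed
    then show ?thesis
      unfolding R_def using norm_le_l1_cart[of "w e"] by (meson order_trans sum_mono)
  qed
  then have sub: "S B \<subseteq> cball 0 R" for B
    unfolding S_def by (intro closure_minimal) auto
  have "cball 0 R \<inter> (\<Inter>B\<in>{B. finite B}. S B) \<noteq> {}"
  proof (rule compact_imp_fip_image)
    fix I :: "'a set set" assume I: "finite I" "I \<subseteq> {B. finite B}"
    then have "finite (\<Union>I)"
      by blast
    then obtain e where e: "norm e = 1" "\<And>b. b \<in> \<Union>I \<Longrightarrow> cinner b e = 0"
      using orthogonal_unit_vector_exists[OF assms(1)] by metis
    \<comment> \<open>Including \<open>{}\<close> also places \<open>w e\<close> in the ball through
      \<open>S {}\<close>, even when \<open>I\<close> is empty.\<close>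
    have "w e \<in> S B" if "B \<in> insert {} I" for B
      unfolding S_def using e that by (intro closure_subset[THEN subsetD] imageI) auto
    then show "cball 0 R \<inter> (\<Inter>B\<in>I. S B) \<noteq> {}"
      using sub[of "{}"] by blast
  qed (simp_all add: S_def)
  then obtain d where d: "\<And>B. finite B \<Longrightarrow> d \<in> S B"
    by blast
  have "essential_value A (\<lambda>k. d $ k)"
    unfolding essential_value_def
  proof (intro allI impI)
    fix B :: "'a set" and \<epsilon> :: real assume "finite B" "\<epsilon> > 0"
    with d[of B] obtain e where e: "norm e = 1" "\<forall>b\<in>B. cinner b e = 0" "dist (w e) d < \<epsilon>"
      unfolding S_def closure_approachable by auto
    have "cmod (cinner e (A k e) - complex_of_real (d $ k)) < \<epsilon>" for k
    proof -
      have "cinner e (A k e) = cinner (A k e) e"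
        using assms(2)[of k] by (simp add: selfadjoint_def is_cadjoint_def)
      \<comment> \<open>Self-adjointness makes the values real, so the real vector
        \<open>w e\<close> loses nothing.\<close>
      then have "Im (cinner e (A k e)) = 0"
        using arg_cong[OF cinner_commute[of e "A k e"], of Im] by simp
      then have "cinner e (A k e) - complex_of_real (d $ k) = complex_of_real ((w e - d) $ k)"
        by (simp add: complex_eq_iff w_def)
      then have "cmod (cinner e (A k e) - complex_of_real (d $ k)) = \<bar>(w e - d) $ k\<bar>"
        by (simp only: norm_of_real)
      also have "\<dots> \<le> norm (w e - d)"
        by (rule component_le_norm_cart)
      finally show ?thesis
        using e(3) by (simp add: dist_norm)
    qed
    with e show "\<exists>e. norm e = 1 \<and> (\<forall>b\<in>B. cinner b e = 0) \<and>
        (\<forall>k. cmod (cinner e (A k e) - complex_of_real (d $ k)) < \<epsilon>)"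
      by blast
  qed
  then show thesis
    by (rule that)
qed

text \<open>The vectors are chosen one at a time, each orthogonal to \<open>B\<close>, to the
  earlier vectors and to their images under all \<open>A k\<close>. Off-diagonal entries then vanish
  exactly, on the other side of the diagonal by self-adjointness, and only the diagonal is
  approximate.\<close>

lemma almost_scalar_compression_exists:
  fixes A :: "'m::finite \<Rightarrow> 'a::complex_inner \<Rightarrow> 'a"
  assumes A: "\<And>k. selfadjoint (A k)"
    and d: "essential_value A d"
    and "finite E" "finite B" "\<epsilon> > 0"
  obtains f where "orthonormal_on E f" "\<And>b e. b \<in> B \<Longrightarrow> e \<in> E \<Longrightarrow> cinner b (f e) = 0"
    "\<And>k e. e \<in> E \<Longrightarrow> cmod (cinner (f e) (A k (f e)) - complex_of_real (d k)) < \<epsilon>"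
    "\<And>k e e'. e \<in> E \<Longrightarrow> e' \<in> E \<Longrightarrow> e \<noteq> e' \<Longrightarrow> cinner (f e) (A k (f e')) = 0"
proof -
  have "\<exists>f. orthonormal_on E f \<and> (\<forall>b\<in>B. \<forall>e\<in>E. cinner b (f e) = 0) \<and>
      (\<forall>k. \<forall>e\<in>E. cmod (cinner (f e) (A k (f e)) - complex_of_real (d k)) < \<epsilon>) \<and>
      (\<forall>k. \<forall>e\<in>E. \<forall>e'\<in>E. e \<noteq> e' \<longrightarrow> cinner (f e) (A k (f e')) = 0)"
    using assms(3)
  proof (induction E)
    case empty
    show ?case by (simp add: orthonormal_on_def)
  next
    case (insert e E)
    from insert.IH obtain f where f: "orthonormal_on E f" "\<forall>b\<in>B. \<forall>e\<in>E. cinner b (f e) = 0"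
      "\<forall>k. \<forall>e\<in>E. cmod (cinner (f e) (A k (f e)) - complex_of_real (d k)) < \<epsilon>"
      "\<forall>k. \<forall>e\<in>E. \<forall>e'\<in>E. e \<noteq> e' \<longrightarrow> cinner (f e) (A k (f e')) = 0"
      by (elim exE conjE)
    have "finite (B \<union> f ` E \<union> (\<Union>k. A k ` f ` E))"
      using assms(4) insert(1) by simp
    with d \<open>\<epsilon> > 0\<close> obtain g where g: "norm g = 1" "\<forall>b\<in>B \<union> f ` E \<union> (\<Union>k. A k ` f ` E). cinner b g = 0"
      "\<forall>k. cmod (cinner g (A k g) - complex_of_real (d k)) < \<epsilon>"
      unfolding essential_value_def by metis
    have g1: "cinner g g = 1"
      using g(1) by (simp add: norm_eq_1_iff_cinner)
    have g2: "cinner (f e') g = 0" "cinner g (f e') = 0" if "e' \<in> E" for e'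
      using g(2) that cinner_eq_0_sym by auto
    have g3: "cinner g (A k (f e')) = 0" "cinner (f e') (A k g) = 0" if "e' \<in> E" for e' k
    proof -
      have *: "cinner (A k (f e')) g = 0"
        using that by (intro g(2)[rule_format]) blast
      then show "cinner g (A k (f e')) = 0"
        using cinner_eq_0_sym by blast
      show "cinner (f e') (A k g) = 0"
        using * A[of k] by (simp add: selfadjoint_def is_cadjoint_def)
    qed
    have ne: "e' \<noteq> e" if "e' \<in> E" for e'
      using insert(2) that by blast
    show ?case
      using f g ne insert(2) by (intro exI[of _ "f(e := g)"])
        (auto simp: orthonormal_on_def g1 g2 g3)
  qed
  then obtain f where f: "orthonormal_on E f" "\<forall>b\<in>B. \<forall>e\<in>E. cinner b (f e) = 0"
      "\<forall>k. \<forall>e\<in>E. cmod (cinner (f e) (A k (f e)) - complex_of_real (d k)) < \<epsilon>"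
      "\<forall>k. \<forall>e\<in>E. \<forall>e'\<in>E. e \<noteq> e' \<longrightarrow> cinner (f e) (A k (f e')) = 0"
    by (elim exE conjE)
  show thesis
    by (rule that[of f]) (use f in auto)
qed

section \<open>From finite rank to compact perturbations\<close>

text \<open>Replacing \<open>G\<close> by finite rank operators within \<open>\<epsilon> / 2\<close>
  on unit vectors moves each entry of a compression by at most \<open>\<epsilon> / 2\<close>. The
  approximants may fail to be self-adjoint, which the definition of the essential range
  allows.\<close>

lemma ess_range_subset_compact_perturbation:
  fixes M :: "complex ^ 'q ^ 'q ^ 'm::finite"
  assumes M: "M \<in> joint_ess_matricial_range A" and G: "\<And>k. compact_op (G k)"
  shows "M \<in> closure (joint_matricial_range (\<lambda>k x. A k x + G k x))"
  unfolding closure_joint_matricial_range_iff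
proof (intro allI impI)
  fix \<epsilon> :: real assume "\<epsilon> > 0"
  then have "\<epsilon> / 2 > 0"
    by simp
  then have "\<forall>k. \<exists>F. finite_rank_op F \<and> (\<forall>x. norm x = 1 \<longrightarrow> norm (G k x - F x) \<le> \<epsilon> / 2)"
    using compact_op_finite_rank_approx[OF G] by metis
  then obtain F where F: "\<And>k. finite_rank_op (F k)"
    "\<And>k x. norm x = 1 \<Longrightarrow> norm (G k x - F k x) \<le> \<epsilon> / 2"
    by metis
  have "M \<in> closure (joint_matricial_range (\<lambda>k x. A k x + F k x))"
    using M F(1) unfolding joint_ess_matricial_range_def by blast
  then obtain x where x: "orthonormal_on UNIV x"
    "\<And>k i j. cmod (cinner (x i) (A k (x j) + F k (x j)) - M $ k $ i $ j) \<le> \<epsilon> / 2"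
    unfolding closure_joint_matricial_range_iff using \<open>\<epsilon> / 2 > 0\<close> by metis
  have "cmod (cinner (x i) (A k (x j) + G k (x j)) - M $ k $ i $ j) \<le> \<epsilon>" for k i j
  proof -
    have "cmod (cinner (x i) (G k (x j) - F k (x j))) \<le> \<epsilon> / 2"
      using cmod_cinner_le[of "x i" "G k (x j) - F k (x j)"] F(2)[of "x j" k]
        orthonormal_on_norm[OF x(1)] by simp
    moreover have "cinner (x i) (A k (x j) + G k (x j)) - M $ k $ i $ j =
        (cinner (x i) (A k (x j) + F k (x j)) - M $ k $ i $ j) + cinner (x i) (G k (x j) - F k (x j))"
      by (simp add: cinner_add_right cinner_diff_right)
    ultimately show ?thesis
      using x(2)[of i k j] norm_triangle_mono[of "cinner (x i) (A k (x j) + F k (x j)) - M $ k $ i $ j"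
        "\<epsilon> / 2" "cinner (x i) (G k (x j) - F k (x j))" "\<epsilon> / 2"] by (simp only: field_sum_of_halves)
  qed
  with x(1) show "\<exists>x. orthonormal_on UNIV x \<and>
      (\<forall>k i j. cmod (cinner (x i) (A k (x j) + G k (x j)) - M $ k $ i $ j) \<le> \<epsilon>)"
    by blast
qed

section \<open>From self-adjoint compact to finite rank perturbations\<close>

text \<open>
  The operator \<open>A + decoupling E d A\<close> is \<open>(I - P) A (I - P) + d P\<close>, where \<open>P\<close> is the
  projection onto the span of \<open>E\<close>.
\<close>

definition decoupling :: "'a::complex_inner set \<Rightarrow> real \<Rightarrow> ('a \<Rightarrow> 'a) \<Rightarrow> 'a \<Rightarrow> 'a"
  where "decoupling E d A x =
    proj E (A (proj E x) + complex_of_real d *\<^sub>C x - A x) - A (proj E x)"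

text \<open>The sum is \<open>cinner x (proj E y)\<close> in coordinates. It is expanded because the
  same coefficients later weight the vectors that replace \<open>E\<close>.\<close>

lemma cinner_decoupling:
  assumes E: "orthonormal_on E (\<lambda>e. e)" "finite E" and A: "selfadjoint A"
  shows "cinner x (A y + decoupling E d A y) =
    cinner (x - proj E x) (A (y - proj E y)) + complex_of_real d * (\<Sum>e\<in>E. cnj (cinner e x) * cinner e y)"
proof -
  have A_diff: "A (y - proj E y) = A y - A (proj E y)"
    using A by (metis bounded_clinear_def linear_simps(2) selfadjoint_def)
  have P: "(\<Sum>e\<in>E. cnj (cinner e x) * cinner e y) = cinner x (proj E y)"
    by (simp add: proj_def cinner_sum_right cinner_scaleC_right mult.commute cinner_commute[symmetric])
  show ?thesis
    unfolding A_diff P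
    by (simp add: decoupling_def cinner_add_right cinner_diff_right cinner_diff_left
        cinner_scaleC_right proj_add proj_diff proj_scaleC cinner_proj_left)
qed

text \<open>Self-adjointness follows by moving \<open>A\<close> and \<open>proj E\<close> across the
  inner product. For compactness, both terms of \<open>D\<close> below contain a factor
  \<open>proj E\<close>, which sends bounded sets into compact ones.\<close>

lemma
  assumes E: "orthonormal_on E (\<lambda>e. e)" "finite E" and A: "selfadjoint A"
  shows selfadjoint_decoupling: "selfadjoint (decoupling E d A)"
    and compact_op_decoupling: "compact_op (decoupling E d A)"
proof -
  have bA: "bounded_clinear A"
    using A by (simp add: selfadjoint_def)
  note P = bounded_clinear_proj[OF E]
  define T where "T x = A (proj E x) + complex_of_real d *\<^sub>C x - A x" for x
  have bT: "bounded_clinear T"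
    unfolding T_def
    by (intro bounded_clinear_diff bounded_clinear_add bounded_clinear_compose[OF bA P] bA
        bounded_clinear_scaleC bounded_clinear_ident)
  have D: "decoupling E d A = (\<lambda>x. proj E (T x) - A (proj E x))"
    by (simp add: decoupling_def T_def fun_eq_iff)
  have bD: "bounded_clinear (decoupling E d A)"
    unfolding D
    by (intro bounded_clinear_diff bounded_clinear_compose[OF P bT] bounded_clinear_compose[OF bA P])
  have sA: "cinner (A x) y = cinner x (A y)" for x y
    using A by (simp add: selfadjoint_def is_cadjoint_def)
  show "selfadjoint (decoupling E d A)"
    unfolding selfadjoint_def is_cadjoint_def using bD
    by (simp add: decoupling_def cinner_add_right cinner_diff_right cinner_add_left cinner_diff_left
        cinner_scaleC_right cinner_scaleC_left cinner_proj_left sA proj_add proj_diff proj_scaleC)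
  show "compact_op (decoupling E d A)"
  proof (rule compact_opI[OF bD])
    fix S :: "'a set" assume S: "bounded S"
    then have "bounded (T ` S)"
      using bT by (simp add: bounded_clinear_def bounded_linear_image)
    then obtain C where C: "compact C" "proj E ` T ` S \<subseteq> C"
      using proj_image_bounded by metis
    obtain C' where C': "compact C'" "proj E ` S \<subseteq> C'"
      using proj_image_bounded[OF S] by metis
    have "compact (A ` C')"
      using bA C'(1)
      by (intro compact_continuous_image linear_continuous_on) (simp_all add: bounded_clinear_def)
    then have "compact {u - v | u v. u \<in> C \<and> v \<in> A ` C'}"
      by (rule compact_differences[OF C(1)])
    moreover have "decoupling E d A ` S \<subseteq> {u - v | u v. u \<in> C \<and> v \<in> A ` C'}"
      unfolding D using C(2) C'(2) by blast
    ultimately show "\<exists>C. compact C \<and> decoupling E d A ` S \<subseteq> C"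
      by blast
  qed
qed

text \<open>A crude termwise bound; it suffices because the tolerance \<delta> it is used with may
  depend on \<open>card E\<close>.\<close>

lemma sum_cmod_coefficients_le:
  assumes "orthonormal_on E (\<lambda>e. e)" "norm x = 1" "norm y = 1"
  shows "(\<Sum>e\<in>E. cmod (cnj (cinner e x) * cinner e y)) \<le> real (card E)"
proof -
  have "cmod (cnj (cinner e x) * cinner e y) \<le> 1" if "e \<in> E" for e
    using cmod_cinner_le[of e x] cmod_cinner_le[of e y] orthonormal_on_norm[OF assms(1) that] assms(2,3)
    by (simp add: norm_mult mult_le_one)
  then show ?thesis
    using sum_mono[of E _ "\<lambda>_. 1::real"] by fastforce
qed

lemma compact_perturbations_subset_finite_rank:
  fixes A :: "'m::finite \<Rightarrow> 'a::complex_inner \<Rightarrow> 'a" and M :: "complex ^ 'q ^ 'q ^ 'm"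
  assumes inf: "\<not> cfinite_dim TYPE('a)" and A: "\<And>k. selfadjoint (A k)"
    and M: "\<And>G. (\<And>k. selfadjoint (G k) \<and> compact_op (G k)) \<Longrightarrow>
      M \<in> closure (joint_matricial_range (\<lambda>k x. A k x + G k x))"
    and F: "\<And>k. finite_rank_op (F k)"
  shows "M \<in> closure (joint_matricial_range (\<lambda>k x. A k x + F k x))"
  unfolding closure_joint_matricial_range_iff
proof (intro allI impI)
  fix \<epsilon> :: real assume "\<epsilon> > 0"
  obtain d where d: "essential_value A d"
    by (rule essential_value_exists[OF inf A])
  have "\<forall>k. \<exists>B. finite B \<and> range (F k) \<subseteq> complex_vector.span B"
    using F unfolding finite_rank_op_def by blast
  then obtain B where "\<forall>k. finite (B k) \<and> range (F k) \<subseteq> complex_vector.span (B k)"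
    by (rule choice[THEN exE])
  then have B: "\<And>k. finite (B k)" "\<And>k x. F k x \<in> complex_vector.span (B k)"
    by blast+
  \<comment> \<open>One \<open>E\<close> captures the ranges of all \<open>F k\<close>, so
    \<open>proj E\<close> fixes every value \<open>F k x\<close>.\<close>
  obtain E where E: "finite E" "orthonormal_on E (\<lambda>e. e)"
    "\<And>b. b \<in> complex_vector.span (\<Union>k. B k) \<Longrightarrow> proj E b = b"
    using orthonormal_basis_exists[of "\<Union>k. B k"] B(1) by (metis finite_UN finite)
  have PF: "proj E (F k x) = F k x" for k x
    using B(2) complex_vector.span_mono[of "B k" "\<Union>k. B k"] by (intro E(3)) blast
  have "selfadjoint (decoupling E (d k) (A k)) \<and> compact_op (decoupling E (d k) (A k))" for k
    using selfadjoint_decoupling compact_op_decoupling E A by metis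
  then have "M \<in> closure (joint_matricial_range (\<lambda>k x. A k x + decoupling E (d k) (A k) x))"
    by (rule M)
  then obtain x where x: "orthonormal_on UNIV x"
    and xM: "\<And>k i j. cmod (cinner (x i) (A k (x j) + decoupling E (d k) (A k) (x j)) - M $ k $ i $ j) \<le> \<epsilon> / 2"
    unfolding closure_joint_matricial_range_iff using \<open>\<epsilon> > 0\<close> by (metis half_gt_zero)
  define y where "y i = x i - proj E (x i)" for i
  define c where "c e i = cinner e (x i)" for e i
  \<comment> \<open>Chosen so that \<open>card E * \<delta>\<close> is at most
    \<open>\<epsilon> / 2\<close>; the \<open>+ 1\<close> covers empty \<open>E\<close>.\<close>
  define \<delta> where "\<delta> = \<epsilon> / (2 * (real (card E) + 1))"
  have "\<delta> > 0"
    using \<open>\<epsilon> > 0\<close> by (simp add: \<delta>_def add_nonneg_pos)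
  \<comment> \<open>The \<open>f e\<close> must avoid \<open>E\<close> so that \<open>F\<close> is
    not seen, the \<open>y i\<close> to preserve inner products, and the \<open>A k (y j)\<close> to
    remove cross terms.\<close>
  have "finite (E \<union> range y \<union> (\<Union>k. range (\<lambda>j. A k (y j))))"
    using E(1) by simp
  then obtain f where f: "orthonormal_on E f"
    and fB: "\<And>b e. b \<in> E \<union> range y \<union> (\<Union>k. range (\<lambda>j. A k (y j))) \<Longrightarrow> e \<in> E \<Longrightarrow> cinner b (f e) = 0"
    and fd: "\<And>k e. e \<in> E \<Longrightarrow> cmod (cinner (f e) (A k (f e)) - complex_of_real (d k)) < \<delta>"
    and ff: "\<And>k e e'. e \<in> E \<Longrightarrow> e' \<in> E \<Longrightarrow> e \<noteq> e' \<Longrightarrow> cinner (f e) (A k (f e')) = 0"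
    using almost_scalar_compression_exists[OF A d E(1) _ \<open>\<delta> > 0\<close>] by metis
  \<comment> \<open>With \<open>J\<close> sending each \<open>e\<close> to \<open>f e\<close>,
    \<open>z i\<close> is \<open>J\<close> applied to \<open>proj E (x i)\<close>, and
    \<open>u\<close> is the modified isometry.\<close>
  define z where "z i = (\<Sum>e\<in>E. c e i *\<^sub>C f e)" for i
  define u where "u i = y i + z i" for i
  have bz: "cinner b (z i) = 0" if "b \<in> E \<union> range y \<union> (\<Union>k. range (\<lambda>j. A k (y j)))" for b i
    unfolding z_def using fB[OF that] by (simp add: cinner_sum_right cinner_scaleC_right)
  have yz: "cinner (y i) (z j) = 0" "cinner (z j) (y i) = 0" for i j
    using bz[of "y i" j] cinner_eq_0_sym by auto
  have Ayz: "cinner (A k (y i)) (z j) = 0" "cinner (z j) (A k (y i)) = 0" for i j k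
    using bz[of "A k (y i)" j] cinner_eq_0_sym by auto
  have yAz: "cinner (y i) (A k (z j)) = 0" for i j k
    using Ayz(1)[of k i j] A[of k] by (simp add: selfadjoint_def is_cadjoint_def)
  have PP: "cinner (proj E (x i)) (proj E (x j)) = (\<Sum>e\<in>E. cnj (c e i) * c e j)" for i j
    unfolding proj_def c_def by (rule cinner_sum_orthonormal[OF E(2,1)])
  have "cinner (u i) (u j) = cinner (x i) (x j)" for i j
  proof -
    have "cinner (z i) (z j) = cinner (proj E (x i)) (proj E (x j))"
      unfolding z_def cinner_sum_orthonormal[OF f E(1)] PP ..
    moreover have "cinner (y i) (y j) = cinner (x i) (x j) - cinner (proj E (x i)) (proj E (x j))"
      by (simp add: y_def cinner_diff_left cinner_diff_right cinner_proj_left proj_proj[OF E(2,1)])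
    ultimately show ?thesis
      by (simp add: u_def cinner_add_left cinner_add_right yz)
  qed
  then have "orthonormal_on UNIV u"
    using x by (simp add: orthonormal_on_def)
  moreover have "cmod (cinner (u i) (A k (u j) + F k (u j)) - M $ k $ i $ j) \<le> \<epsilon>" for k i j
  proof -
    \<comment> \<open>\<open>y i\<close> has lost its component along \<open>E\<close>, and
      \<open>z i\<close> is orthogonal to \<open>E\<close> by the choice of
      \<open>f\<close>.\<close>
    have eu: "cinner e (u i) = 0" if "e \<in> E" for e
      using cinner_proj_right[OF E(2,1) that, of "x i"] bz[of e i] that
      by (simp add: u_def y_def cinner_add_right cinner_diff_right)
    have "cinner (u i) (F k (u j)) = cinner (proj E (u i)) (F k (u j))"
      by (simp add: cinner_proj_left PF)
    also have "\<dots> = 0"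
      by (simp add: proj_def eu)
    finally have uF: "cinner (u i) (F k (u j)) = 0" .
    have A_add: "A k (a + b) = A k a + A k b" and A_scale: "A k (r *\<^sub>C a) = r *\<^sub>C A k a" for a b r
      using A[of k] by (simp_all add: selfadjoint_def bounded_clinear_def clinear_iff)
    have A_sum: "A k (\<Sum>e\<in>E. g e) = (\<Sum>e\<in>E. A k (g e))" for g
      using A[of k] by (simp add: selfadjoint_def bounded_clinear_def bounded_linear.linear linear_sum)
    have "cinner (z i) (A k (z j)) = (\<Sum>e\<in>E. \<Sum>e'\<in>E. cnj (c e i) * c e' j * cinner (f e) (A k (f e')))"
      by (simp add: z_def A_sum A_scale cinner_sum_left cinner_sum_right cinner_scaleC_left
          cinner_scaleC_right sum_distrib_left mult_ac) (rule sum.swap)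
    also have "\<dots> = (\<Sum>e\<in>E. \<Sum>e'\<in>E. if e = e' then cnj (c e i) * c e j * cinner (f e) (A k (f e)) else 0)"
      using ff by (intro sum.cong refl) auto
    also have "\<dots> = (\<Sum>e\<in>E. cnj (c e i) * c e j * cinner (f e) (A k (f e)))"
      using E(1) by simp
    finally have zz: "cinner (z i) (A k (z j)) = \<dots>" .
    have "cinner (u i) (A k (u j) + F k (u j)) = cinner (y i) (A k (y j)) + cinner (z i) (A k (z j))"
      by (simp add: cinner_add_right uF)
        (simp add: u_def A_add cinner_add_left cinner_add_right Ayz yAz)
    \<comment> \<open>Both compressions share the \<open>y\<close> part, so only the deviation of
      the diagonal entries on the \<open>f e\<close> from \<open>d k\<close> survives.\<close>
    then have "cinner (u i) (A k (u j) + F k (u j))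
          - cinner (x i) (A k (x j) + decoupling E (d k) (A k) (x j))
        = (\<Sum>e\<in>E. cnj (c e i) * c e j * (cinner (f e) (A k (f e)) - complex_of_real (d k)))"
      by (simp add: cinner_decoupling[OF E(2,1) A] zz flip: y_def c_def)
        (simp add: sum_distrib_left sum_subtractf[symmetric] algebra_simps)
    also have "cmod \<dots> \<le> (\<Sum>e\<in>E. cmod (cnj (c e i) * c e j) * \<delta>)"
      using fd by (intro sum_norm_le) (simp add: norm_mult less_imp_le mult_left_mono)
    also have "\<dots> = (\<Sum>e\<in>E. cmod (cnj (c e i) * c e j)) * \<delta>"
      by (simp only: sum_distrib_right)
    also have "\<dots> \<le> real (card E) * \<delta>"
      using \<open>\<delta> > 0\<close> orthonormal_on_norm[OF x]
      by (intro mult_right_mono) (simp_all add: c_def sum_cmod_coefficients_le[OF E(2)] del: complex_cnj_mult norm_mult)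
    also have "\<dots> \<le> \<epsilon> / 2"
      using \<open>\<epsilon> > 0\<close> by (simp add: \<delta>_def field_simps)
    finally show ?thesis
      using norm_diff_triangle_le[OF _ xM[of i k j]] by (metis field_sum_of_halves)
  qed
  ultimately show "\<exists>x. orthonormal_on UNIV x \<and>
      (\<forall>k i j. cmod (cinner (x i) (A k (x j) + F k (x j)) - M $ k $ i $ j) \<le> \<epsilon>)"
    by blast
qed

theorem proposition4p5:
  fixes A :: "'m::finite \<Rightarrow> 'a::chilbert_space \<Rightarrow> 'a"
  assumes "\<not> cfinite_dim TYPE('a)"
    and "\<And>k. selfadjoint (A k)"
  shows "(joint_ess_matricial_range A :: (complex ^ 'q ^ 'q ^ 'm) set) =
    \<Inter> {closure (joint_matricial_range (\<lambda>k x. A k x + G k x)) | G.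
        \<forall>k. selfadjoint (G k) \<and> compact_op (G k)}"
proof (intro subset_antisym subsetI)
  fix M :: "complex ^ 'q ^ 'q ^ 'm"
  assume "M \<in> joint_ess_matricial_range A"
  then show "M \<in> \<Inter> {closure (joint_matricial_range (\<lambda>k x. A k x + G k x)) | G.
      \<forall>k. selfadjoint (G k) \<and> compact_op (G k)}"
    using ess_range_subset_compact_perturbation[of M A] by blast
next
  fix M :: "complex ^ 'q ^ 'q ^ 'm"
  assume "M \<in> \<Inter> {closure (joint_matricial_range (\<lambda>k x. A k x + G k x)) | G.
      \<forall>k. selfadjoint (G k) \<and> compact_op (G k)}"
  then have M: "M \<in> closure (joint_matricial_range (\<lambda>k x. A k x + G k x))"
    if "\<And>k. selfadjoint (G k) \<and> compact_op (G k)" for G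
    using that by blast
  have "M \<in> closure (joint_matricial_range (\<lambda>k x. A k x + F k x))" if "\<forall>k. finite_rank_op (F k)" for F
    using compact_perturbations_subset_finite_rank[OF assms M] that by blast
  then show "M \<in> joint_ess_matricial_range A"
    unfolding joint_ess_matricial_range_def by blast
qed

end
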